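(* The tempered xi function $\widehat\xi:\mathbb C\to\mathbb C$ has infinitely many distinct zeros $s$ satisfying $\Re s\ne\frac12$. Moreover, only finitely many zeros of $\widehat\xi$ lie on the critical line $\Re s=\frac12$, and $s=\frac12$ is a simple zero of $\widehat\xi$.
   Context: For $x\ge1$ let \[ \Phi(x)=\sum_{n=1}^\infty e^{-\pi n^2x},\qquad M(x)=x^{-1/4}\frac{d}{dx}\left(x^{3/2}\Phi'(x)\right). \] The tempered xi function is defined by \[ \widehat\xi(s)=4\int_1^\infty M(x)\sinh\left(\frac12\left(s-\frac12\right)\log x\right)dx,\qquad s\in\mathbb C. \] *)

theory Defs
  imports "HOL-Complex_Analysis.Complex_Analysis"
begin

text \<open>
  The series converges for every \<open>x > 0\<close>, so the two-sided derivatives below are meaningful on all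
  of \<open>x \<ge> 1\<close>, the endpoint included. Only these values are ever used.
\<close>

definition Phi :: "real \<Rightarrow> real" where
  "Phi x = (\<Sum>n. exp (- pi * (real (Suc n))\<^sup>2 * x))"

definition M :: "real \<Rightarrow> real" where
  "M x = x powr (- 1 / 4) * deriv (\<lambda>y. y powr (3 / 2) * deriv Phi y) x"

definition tempered_xi :: "complex \<Rightarrow> complex" where
  "tempered_xi s =
     4 * (LBINT x:{1..}. complex_of_real (M x) * sinh (1 / 2 * (s - 1 / 2) * complex_of_real (ln x)))"

text \<open>
  Analyticity is required explicitly, since \<^const>\<open>zorder\<close> is only meaningful at an isolated
  singularity or a point of analyticity.
\<close>

definition simple_zero :: "(complex \<Rightarrow> complex) \<Rightarrow> complex \<Rightarrow> bool" where
  "simple_zero f z \<longleftrightarrow> f analytic_on {z} \<and> f z = 0 \<and> zorder f z = 1"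

end

theory Submission
  imports Defs "HOL-Real_Asymp.Real_Asymp"
begin

text \<open>
  Differentiating termwise, \<open>M(x) = x\<^sup>1\<^sup>/\<^sup>4 \<Sum>\<^sub>n (\<pi>\<^sup>2n\<^sup>4x - 3\<pi>n\<^sup>2/2) exp (- \<pi>n\<^sup>2x)\<close>, which is positive for
  \<open>x \<ge> 1\<close>. Positivity makes the derivative of the tempered xi function at \<open>1/2\<close> positive.
  On the critical line, integration by parts gives the leading term
  \<open>8\<i> M(1) / t\<close> with an error \<open>O(t\<^sup>-\<^sup>2)\<close>, so zeros there are bounded and hence finite in number.
  As a function of \<open>w = s - 1/2\<close> the function grows at most like \<open>exp (D (1 + |w|)\<^sup>3\<^sup>/\<^sup>2)\<close>. With only
  finitely many zeros it would therefore be a polynomial times \<open>exp (a w + b)\<close>, by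
  Borel--Caratheodory. But positivity of \<open>M\<close> on arbitrarily distant intervals makes it grow
  faster than every exponential along the positive real axis.
\<close>

subsection \<open>Entire functions with finitely many zeros\<close>

lemma Borel_Caratheodory_half:
  assumes holf: "f holomorphic_on ball 0 R" and f0: "f 0 = 0"
    and A: "\<And>z. norm z < R \<Longrightarrow> Re (f z) < A"
    and R: "R > 0" and z: "2 * norm z \<le> R"
  shows "norm (f z) \<le> 2 * A"
proof -
  have Apos: "A > 0"
    using A[of 0] f0 R by simp
  define g where "g \<zeta> = f (of_real R * \<zeta>) / (of_real (2 * A) - f (of_real R * \<zeta>))" for \<zeta>
  have inb: "norm (of_real R * \<zeta> :: complex) < R" if "norm \<zeta> < 1" for \<zeta> :: complex
    using that R by (simp add: norm_mult)
  have less: "norm (f w) < norm (of_real (2 * A) - f w)" if "norm w < R" for w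
  proof -
    have "(norm (f w))\<^sup>2 < (norm (of_real (2 * A) - f w))\<^sup>2"
      using A[OF that] Apos unfolding cmod_power2 by (simp add: power2_eq_square algebra_simps)
    then show ?thesis
      using power_less_imp_less_base by fastforce
  qed
  have nz: "of_real (2 * A) - f w \<noteq> 0" if "norm w < R" for w
    using less[OF that] by (metis norm_zero norm_not_less_zero)
  have schwarz: "norm (g \<zeta>) \<le> norm \<zeta>" if "norm \<zeta> < 1" for \<zeta>
  proof (rule Schwarz_Lemma(1))
    have "(\<lambda>\<zeta>. f (of_real R * \<zeta>)) holomorphic_on ball 0 1"
      by (rule holomorphic_on_compose_gen[of "\<lambda>\<zeta>. of_real R * \<zeta>" _ f "ball 0 R", unfolded o_def])
         (auto intro!: holomorphic_intros holf inb)
    then show "g holomorphic_on ball 0 1"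
      unfolding g_def using nz inb by (intro holomorphic_intros) auto
    show "g 0 = 0" by (simp add: g_def f0)
    show "norm (g w) < 1" if "norm w < 1" for w
      using less[OF inb[OF that]] nz[OF inb[OF that]] by (simp add: g_def norm_divide divide_simps)
  qed (use that in auto)
  have zR: "norm z < R" using z R by (smt (verit) norm_ge_zero)
  have "norm (z / of_real R) \<le> 1 / 2" using z R by (simp add: norm_divide field_simps)
  then have "norm (g (z / of_real R)) \<le> 1 / 2"
    using schwarz[of "z / of_real R"] by linarith
  then have "norm (f z) / norm (of_real (2 * A) - f z) \<le> 1 / 2"
    using R by (simp add: g_def norm_divide)
  moreover have "norm (of_real (2 * A) - f z) > 0"
    using nz[OF zR] by simp
  ultimately have "2 * norm (f z) \<le> norm (of_real (2 * A) - f z)"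
    by (simp add: field_simps)
  also have "\<dots> \<le> norm (of_real (2 * A) :: complex) + norm (f z)"
    by (rule norm_triangle_ineq4)
  also have "norm (of_real (2 * A) :: complex) = 2 * A"
    using Apos by (simp only: norm_of_real)
  finally show ?thesis by simp
qed

lemma entire_Re_subquadratic_imp_affine:
  assumes holf: "f holomorphic_on UNIV"
    and le: "\<And>z. Re (f z) \<le> C * (1 + norm z) powr (3 / 2)"
  obtains a b where "\<And>z. f z = a * z + b"
proof -
  define g where "g z = f z - f 0" for z
  define B where "B r = 2 * (\<bar>C\<bar> * (1 + 2 * r) powr (3 / 2) + norm (f 0) + 1)" for r
  have holg: "g holomorphic_on S" for S
    unfolding g_def using holf by (intro holomorphic_intros) (auto elim: holomorphic_on_subset)
  have bound: "norm (g z) \<le> B (norm z)" if "z \<noteq> 0" for z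
    unfolding B_def
  proof (rule Borel_Caratheodory_half[where f = g and z = z and R = "2 * norm z"])
    show "Re (g w) < \<bar>C\<bar> * (1 + 2 * norm z) powr (3 / 2) + norm (f 0) + 1"
      if "norm w < 2 * norm z" for w
    proof -
      have "Re (f w) \<le> C * (1 + norm w) powr (3 / 2)" by (rule le)
      also have "\<dots> \<le> \<bar>C\<bar> * (1 + norm w) powr (3 / 2)" by (intro mult_right_mono) auto
      also have "\<dots> \<le> \<bar>C\<bar> * (1 + 2 * norm z) powr (3 / 2)"
        using that by (intro mult_left_mono powr_mono2) auto
      finally have "Re (f w) \<le> \<dots>" .
      moreover have "- Re (f 0) \<le> norm (f 0)"
        using abs_Re_le_cmod[of "f 0"] by linarith
      ultimately show ?thesis by (simp add: g_def)
    qed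
  qed (use that holg in \<open>auto simp: g_def\<close>)
  have B: "((\<lambda>r. B r / r ^ 2) \<longlongrightarrow> 0) at_top"
  proof -
    have 1: "((\<lambda>r::real. (1 + 2 * r) powr (3 / 2) / r ^ 2) \<longlongrightarrow> 0) at_top" by real_asymp
    have 2: "((\<lambda>r::real. 1 / r ^ 2) \<longlongrightarrow> 0) at_top" by real_asymp
    have "((\<lambda>r. 2 * \<bar>C\<bar> * ((1 + 2 * r) powr (3 / 2) / r ^ 2) + 2 * (norm (f 0) + 1) * (1 / r ^ 2))
        \<longlongrightarrow> 2 * \<bar>C\<bar> * 0 + 2 * (norm (f 0) + 1) * 0) at_top"
      by (intro tendsto_intros 1 2)
    then show ?thesis by (simp add: B_def distrib_left add_divide_distrib add_ac mult.assoc)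
  qed
  have d0: "(deriv ^^ n) g 0 = 0" if "n \<ge> 2" for n
  proof -
    have "norm ((deriv ^^ n) g 0) \<le> 0"
    proof (rule tendsto_lowerbound)
      show "((\<lambda>r. fact n * (B r / r ^ 2)) \<longlongrightarrow> 0) at_top"
        using tendsto_mult_right_zero[OF B] by simp
      show "\<forall>\<^sub>F r in at_top. norm ((deriv ^^ n) g 0) \<le> fact n * (B r / r ^ 2)"
        using eventually_ge_at_top[of 1]
      proof eventually_elim
        case (elim r)
        have "norm ((deriv ^^ n) g 0) \<le> fact n * B r / r ^ n"
        proof (rule Cauchy_inequality)
          show "norm (g x) \<le> B r" if "norm (0 - x) = r" for x
          proof -
            have "x \<noteq> 0" "norm x = r" using that elim by auto
            then show ?thesis using bound[of x] by simp
          qed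
        qed (use elim in \<open>auto intro!: holg holomorphic_on_imp_continuous_on\<close>)
        also have "\<dots> \<le> fact n * B r / r ^ 2"
          using elim that by (intro divide_left_mono power_increasing) (auto simp: B_def)
        finally show ?case by simp
      qed
    qed auto
    then show ?thesis by simp
  qed
  have "g z = deriv g 0 * z" for z
  proof -
    have "(\<lambda>n. (deriv ^^ n) g 0 / fact n * (z - 0) ^ n) sums g z"
      by (rule holomorphic_power_series[where r = "norm z + 1"]) (auto intro: holg)
    moreover have "(\<lambda>n. (deriv ^^ n) g 0 / fact n * (z - 0) ^ n) sums
        (\<Sum>n\<in>{1}. (deriv ^^ n) g 0 / fact n * (z - 0) ^ n)"
    proof (rule sums_finite)
      fix n :: nat assume "n \<notin> {1}"
      then consider "n = 0" | "n \<ge> 2" by force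
      then show "(deriv ^^ n) g 0 / fact n * (z - 0) ^ n = 0"
      proof cases
        case 1
        then show ?thesis by (simp add: g_def)
      next
        case 2
        then show ?thesis using d0 by simp
      qed
    qed auto
    ultimately show ?thesis by (simp add: sums_iff)
  qed
  then have "f z - f 0 = deriv g 0 * z" for z
    by (metis g_def)
  then have "f z = deriv g 0 * z + f 0" for z
    by (metis diff_eq_eq)
  then show ?thesis by (rule that)
qed

lemma entire_finite_zeros_factorization:
  assumes holf: "f holomorphic_on UNIV" and nz: "f w0 \<noteq> 0"
    and fin: "finite {z. f z = 0}"
  obtains h and m :: "complex \<Rightarrow> nat" where "h holomorphic_on UNIV"
    "\<And>z. f z = exp (h z) * (\<Prod>a\<in>{z. f z = 0}. (z - a) ^ m a)"
proof -
  define Z where "Z = {z. f z = 0}"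
  define m where "m a = nat (zorder f a)" for a
  define P where "P z = (\<Prod>a\<in>Z. (z - a) ^ m a)" for z
  have [simp]: "finite Z" using fin by (simp add: Z_def)
  have ex: "\<exists>w\<in>UNIV. f w \<noteq> 0" using nz by blast
  have zo: "if f z = 0 then zorder f z > 0 else zorder f z = 0" for z
    using zorder_exist_zero[OF holf open_UNIV connected_UNIV UNIV_I ex, of z] by (rule conjunct1)
  have mpos: "m a > 0" if "f a = 0" for a
    using zo[of a] that by (simp add: m_def)
  have P0: "P z = 0 \<longleftrightarrow> f z = 0" for z
    using mpos[of z] by (auto simp: P_def Z_def fin)
  have holP: "P holomorphic_on S" for S
    unfolding P_def by (intro holomorphic_intros)
  have zP: "zorder P z = zorder f z" for z
  proof (cases "f z = 0")
    case True
    then have "z \<in> Z" by (simp add: Z_def)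
    define Q where "Q w = (\<Prod>a\<in>Z - {z}. (w - a) ^ m a)" for w
    have "Q holomorphic_on UNIV"
      unfolding Q_def by (intro holomorphic_intros)
    then show ?thesis
    proof (rule zorder_eqI[of UNIV _ Q, rotated 2])
      fix w
      have "P w = (w - z) ^ m z * Q w"
        unfolding P_def Q_def by (rule prod.remove) (use \<open>z \<in> Z\<close> in auto)
      moreover have "(w - z) powi zorder f z = (w - z) ^ m z"
        using zo[of z] True by (simp add: m_def power_int_def)
      ultimately show "P w = Q w * (w - z) powi zorder f z"
        by (simp only: mult.commute)
    qed (auto simp: Q_def)
  next
    case False
    have "P analytic_on {z}"
      using holP[of UNIV] by (simp add: analytic_on_holomorphic) blast
    then show ?thesis using False P0[of z] zo[of z] zorder_eq_0I[of P z] by auto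
  qed
  obtain u where u: "u holomorphic_on UNIV" "\<And>z. u z \<noteq> 0" "\<And>z. f z = u z * P z"
    by (rule holomorphic_zorder_factorization[OF holf open_UNIV connected_UNIV holP P0 zP]) auto
  obtain h where h: "h holomorphic_on UNIV" "\<And>z. exp (h z) = u z"
    by (rule holomorphic_logarithm_exists[OF convex_UNIV open_UNIV u(1)]) (use u(2) in auto)
  show ?thesis
  proof (rule that[OF h(1)])
    show "f z = exp (h z) * (\<Prod>a\<in>{z. f z = 0}. (z - a) ^ m a)" for z
      using u(3)[of z] unfolding h(2) P_def Z_def .
  qed
qed

lemma entire_finite_zeros_imp_exponential_type:
  assumes holf: "f holomorphic_on UNIV" and fin: "finite {z. f z = 0}"
    and le: "\<And>z. norm (f z) \<le> exp (C * (1 + norm z) powr (3 / 2))"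
  obtains A c where "\<And>z. norm (f z) \<le> A * exp (c * norm z)"
proof (cases "\<forall>z. f z = 0")
  case True
  then show ?thesis by (intro that[of 0 0]) auto
next
  case False
  then obtain w0 where "f w0 \<noteq> 0" by blast
  then obtain h and m :: "complex \<Rightarrow> nat" where holh: "h holomorphic_on UNIV"
    and f: "\<And>z. f z = exp (h z) * (\<Prod>a\<in>{z. f z = 0}. (z - a) ^ m a)"
    by (rule entire_finite_zeros_factorization[OF holf _ fin]) (rule that)
  define Z where "Z = {z. f z = 0}"
  define P where "P z = (\<Prod>a\<in>Z. (z - a) ^ m a)" for z
  have [simp]: "finite Z" using fin by (simp add: Z_def)
  have f: "f z = exp (h z) * P z" for z
    unfolding P_def Z_def by (rule f)
  define R where "R = 1 + (\<Sum>a\<in>Z. norm a)"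
  have P1: "norm (P z) \<ge> 1" if "norm z \<ge> R" for z
    unfolding P_def prod_norm [symmetric]
  proof (rule prod_ge_1)
    fix a assume "a \<in> Z"
    then have "norm a \<le> (\<Sum>a\<in>Z. norm a)" by (intro member_le_sum) auto
    then have "1 \<le> norm (z - a)"
      using that norm_triangle_ineq2[of z a] by (simp add: R_def)
    then show "1 \<le> norm ((z - a) ^ m a)" by (simp add: norm_power one_le_power)
  qed
  have "compact ((\<lambda>z. Re (h z)) ` cball 0 R)"
    by (intro compact_continuous_image continuous_intros holomorphic_on_imp_continuous_on
          holomorphic_on_subset[OF holh]) auto
  then obtain K where "\<forall>x\<in>(\<lambda>z. Re (h z)) ` cball 0 R. norm x \<le> K"
    using compact_imp_bounded bounded_iff by metis
  then have K: "\<bar>Re (h z)\<bar> \<le> K" if "norm z \<le> R" for z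
    using that by simp
  have "Re (h z) \<le> (\<bar>C\<bar> + \<bar>K\<bar>) * (1 + norm z) powr (3 / 2)" for z
  proof (cases "norm z \<le> R")
    case True
    have "Re (h z) \<le> \<bar>K\<bar> * 1" using K[OF True] by simp
    also have "\<dots> \<le> (\<bar>C\<bar> + \<bar>K\<bar>) * (1 + norm z) powr (3 / 2)"
      by (intro mult_mono ge_one_powr_ge_zero) auto
    finally show ?thesis .
  next
    case False
    then have "exp (Re (h z)) * 1 \<le> exp (Re (h z)) * norm (P z)"
      by (intro mult_left_mono P1) auto
    also have "\<dots> \<le> exp (C * (1 + norm z) powr (3 / 2))"
      using le[of z] unfolding f norm_mult norm_exp_eq_Re .
    finally have "Re (h z) \<le> C * (1 + norm z) powr (3 / 2)" by simp
    also have "\<dots> \<le> (\<bar>C\<bar> + \<bar>K\<bar>) * (1 + norm z) powr (3 / 2)"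
      by (intro mult_right_mono) auto
    finally show ?thesis .
  qed
  then obtain a b where h: "\<And>z. h z = a * z + b"
    by (rule entire_Re_subquadratic_imp_affine[OF holh]) (rule that)
  define k where "k = (\<Sum>a\<in>Z. real (m a))"
  define l where "l = (\<Sum>a\<in>Z. real (m a) * norm a)"
  have "norm (P z) \<le> exp (k * norm z + l)" for z
  proof -
    have "norm (P z) \<le> (\<Prod>a\<in>Z. exp (real (m a) * (norm z + norm a)))"
      unfolding P_def prod_norm [symmetric]
    proof (intro prod_mono conjI)
      fix a
      have "norm (z - a) \<le> exp (norm z + norm a)"
        using norm_triangle_ineq4[of z a] exp_ge_add_one_self[of "norm z + norm a"] by linarith
      then show "norm ((z - a) ^ m a) \<le> exp (real (m a) * (norm z + norm a))"
        unfolding norm_power exp_of_nat_mult by (rule power_mono) simp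
    qed auto
    also have "\<dots> = exp (k * norm z + l)"
      unfolding exp_sum [OF \<open>finite Z\<close>, symmetric] k_def l_def
      by (simp add: distrib_left sum.distrib sum_distrib_right)
    finally show ?thesis .
  qed
  moreover have "norm (exp (h z)) \<le> exp (norm a * norm z + norm b)" for z
  proof -
    have "norm (exp (h z)) \<le> exp (norm (h z))" by (rule norm_exp)
    also have "norm (h z) \<le> norm a * norm z + norm b"
      using norm_triangle_ineq[of "a * z" b] by (simp add: h norm_mult)
    finally show ?thesis by simp
  qed
  ultimately have "norm (f z) \<le> exp (norm a * norm z + norm b) * exp (k * norm z + l)" for z
    unfolding f norm_mult by (intro mult_mono norm_ge_zero exp_ge_zero)
  moreover have "exp (norm a * norm z + norm b) * exp (k * norm z + l)
      = exp (norm b + l) * exp ((norm a + k) * norm z)" for z :: complex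
    unfolding exp_add [symmetric] by (simp add: algebra_simps)
  ultimately have "norm (f z) \<le> exp (norm b + l) * exp ((norm a + k) * norm z)" for z
    by simp
  then show ?thesis by (rule that)
qed

subsection \<open>Theta sums\<close>

definition theta_moment :: "nat \<Rightarrow> real \<Rightarrow> real" where
  "theta_moment k x = (\<Sum>n. (pi * (real (Suc n))\<^sup>2) ^ k * exp (- (pi * (real (Suc n))\<^sup>2) * x))"

lemma summable_theta_moment:
  fixes x :: real
  assumes "x > 0"
  shows "summable (\<lambda>n. (pi * (real (Suc n))\<^sup>2) ^ k * exp (- (pi * (real (Suc n))\<^sup>2) * x))"
proof (rule summable_comparison_test_bigo)
  show "summable (\<lambda>n. norm (inverse (real (Suc n) ^ 2)))"
    using inverse_power_summable[of 2, where 'a = real] by (subst summable_Suc_iff) simp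
  have "(\<lambda>y::real. (pi * y) ^ k * exp (- (pi * y) * x)) \<in> O(\<lambda>y. inverse y)"
    using assms by real_asymp
  moreover have "filterlim (\<lambda>n. (real (Suc n))\<^sup>2) at_top at_top"
    by real_asymp
  ultimately show "(\<lambda>n. (pi * (real (Suc n))\<^sup>2) ^ k * exp (- (pi * (real (Suc n))\<^sup>2) * x))
      \<in> O(\<lambda>n. inverse ((real (Suc n))\<^sup>2))"
    by (rule landau_o.big.compose)
qed

lemma theta_moment_pos:
  assumes "x > 0"
  shows "theta_moment k x > 0"
  unfolding theta_moment_def by (rule suminf_pos[OF summable_theta_moment[OF assms]]) simp

lemma theta_moment_le_Suc:
  assumes "x > 0"
  shows "pi * theta_moment k x \<le> theta_moment (Suc k) x"
  unfolding theta_moment_def suminf_mult[OF summable_theta_moment[OF assms], symmetric]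
proof (rule suminf_le)
  fix n
  have "1 * 1 \<le> (real (Suc n))\<^sup>2" unfolding power2_eq_square by (intro mult_mono) auto
  then have "pi * 1 \<le> pi * (real (Suc n))\<^sup>2" by (intro mult_left_mono) auto
  then show "pi * ((pi * (real (Suc n))\<^sup>2) ^ k * exp (- (pi * (real (Suc n))\<^sup>2) * x))
      \<le> (pi * (real (Suc n))\<^sup>2) ^ Suc k * exp (- (pi * (real (Suc n))\<^sup>2) * x)"
    unfolding power_Suc mult.assoc[symmetric] by (intro mult_right_mono) auto
qed (intro summable_mult summable_theta_moment[OF assms])+

lemma theta_moment_le_exp:
  assumes "x \<ge> 1"
  shows "theta_moment k x \<le> theta_moment k 1 * exp pi * exp (- pi * x)"
proof -
  define l where "l n = pi * (real (Suc n))\<^sup>2" for n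
  have sm: "summable (\<lambda>n. l n ^ k * exp (- l n * y))" if "y > 0" for y
    using summable_theta_moment[OF that] by (simp add: l_def)
  have l: "pi \<le> l n" for n
  proof -
    have "1 * 1 \<le> (real (Suc n))\<^sup>2" unfolding power2_eq_square by (intro mult_mono) auto
    then show ?thesis unfolding l_def by simp
  qed
  have "theta_moment k x = (\<Sum>n. l n ^ k * exp (- l n * x))"
    by (simp add: theta_moment_def l_def)
  also have "\<dots> \<le> (\<Sum>n. exp (- pi * (x - 1)) * (l n ^ k * exp (- l n * 1)))"
  proof (rule suminf_le)
    fix n
    have "pi * (x - 1) \<le> l n * (x - 1)" using assms l by (intro mult_right_mono) auto
    then have "exp (- l n * x) \<le> exp (- pi * (x - 1)) * exp (- l n * 1)"
      unfolding exp_add[symmetric] by (simp add: algebra_simps)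
    moreover have "l n ^ k \<ge> 0" using l[of n] pi_gt_zero by (intro zero_le_power) linarith
    ultimately show "l n ^ k * exp (- l n * x) \<le> exp (- pi * (x - 1)) * (l n ^ k * exp (- l n * 1))"
      using mult_left_mono by (fastforce simp: mult_ac)
  qed (use assms sm[of x] sm[of 1] in \<open>auto intro: summable_mult\<close>)
  also have "\<dots> = exp (- pi * (x - 1)) * theta_moment k 1"
    using sm[of 1] by (subst suminf_mult) (auto simp: theta_moment_def l_def)
  also have "exp (- pi * (x - 1)) = exp pi * exp (- pi * x)"
    unfolding exp_add[symmetric] by (simp add: algebra_simps)
  finally show ?thesis by (simp add: mult_ac)
qed

lemma has_real_derivative_theta_moment:
  assumes "x > 0"
  shows "(theta_moment k has_real_derivative - theta_moment (Suc k) x) (at x)"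
proof -
  define l where "l n = pi * (real (Suc n))\<^sup>2" for n
  have sm: "summable (\<lambda>n. l n ^ j * exp (- l n * y))" if "y > 0" for y j
    using summable_theta_moment[OF that] by (simp add: l_def)
  have l0: "l n > 0" for n by (simp add: l_def)
  have "((\<lambda>x. \<Sum>n. l n ^ k * exp (- l n * x)) has_real_derivative
      (\<Sum>n. - (l n ^ Suc k * exp (- l n * x)))) (at x)"
  proof (rule has_field_derivative_series'(2)[of "{x/2<..}" _ _ x])
    show "((\<lambda>x. l n ^ k * exp (- l n * x)) has_real_derivative - (l n ^ Suc k * exp (- l n * y)))
        (at y within {x/2<..})" for n y
      by (auto intro!: derivative_eq_intros)
    show "uniformly_convergent_on {x/2<..} (\<lambda>n y. \<Sum>i<n. - (l i ^ Suc k * exp (- l i * y)))"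
    proof (rule Weierstrass_m_test'_ev)
      show "summable (\<lambda>n. l n ^ Suc k * exp (- l n * (x/2)))"
        using assms by (intro sm) auto
      show "\<forall>\<^sub>F n in sequentially. \<forall>y\<in>{x/2<..}.
          norm (- (l n ^ Suc k * exp (- l n * y))) \<le> l n ^ Suc k * exp (- l n * (x/2))"
        using l0 by (intro always_eventually allI ballI) (auto simp: abs_mult less_imp_le)
    qed
  qed (use assms sm in \<open>auto simp: interior_open\<close>)
  also have "(\<Sum>n. - (l n ^ Suc k * exp (- l n * x))) = - theta_moment (Suc k) x"
    using sm[OF assms, of "Suc k"] by (subst suminf_minus) (auto simp: theta_moment_def l_def)
  also have "(\<lambda>x. \<Sum>n. l n ^ k * exp (- l n * x)) = theta_moment k"
    by (simp add: theta_moment_def l_def fun_eq_iff)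
  finally show ?thesis .
qed

lemma M_eq_theta_moment:
  assumes "x > 0"
  shows "M x = x powr (5 / 4) * theta_moment 2 x + (- 3 / 2) * (x powr (1 / 4) * theta_moment 1 x)"
proof -
  have Phi: "Phi = theta_moment 0"
    by (simp add: fun_eq_iff Phi_def theta_moment_def)
  have d: "deriv Phi y = - theta_moment 1 y" if "y > 0" for y
    using has_real_derivative_theta_moment[OF that, of 0] by (simp add: Phi DERIV_imp_deriv)
  have "((\<lambda>y. y powr (3 / 2) * (- theta_moment 1 y)) has_real_derivative
      x powr (3 / 2) * theta_moment 2 x - 3 / 2 * x powr (1 / 2) * theta_moment 1 x) (at x)"
    using assms has_real_derivative_theta_moment[OF assms, of 1]
    by (auto intro!: derivative_eq_intros simp: numeral_2_eq_2)
  then have "((\<lambda>y. y powr (3 / 2) * deriv Phi y) has_real_derivative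
      x powr (3 / 2) * theta_moment 2 x - 3 / 2 * x powr (1 / 2) * theta_moment 1 x) (at x)"
    by (rule has_field_derivative_transform_within_open[of _ _ _ "{0<..}"]) (use assms d in auto)
  then have "M x = x powr (- 1 / 4) *
      (x powr (3 / 2) * theta_moment 2 x - 3 / 2 * x powr (1 / 2) * theta_moment 1 x)"
    by (simp add: M_def DERIV_imp_deriv)
  also have "\<dots> = (x powr (- 1 / 4) * x powr (3 / 2)) * theta_moment 2 x
      + (- 3 / 2) * ((x powr (- 1 / 4) * x powr (1 / 2)) * theta_moment 1 x)"
    by (simp add: algebra_simps)
  finally show ?thesis
    unfolding powr_add [symmetric] by simp
qed

lemma M_pos:
  assumes "x \<ge> 1"
  shows "M x > 0"
proof -
  have x: "x > 0" using assms by simp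
  have "M x = x powr (1 / 4) * (x * theta_moment 2 x - 3 / 2 * theta_moment 1 x)"
    using x unfolding M_eq_theta_moment[OF x]
    by (simp add: algebra_simps powr_mult_base)
  moreover have "3 / 2 * theta_moment 1 x < pi * theta_moment 1 x"
    using theta_moment_pos[OF x, of 1] pi_gt3 by (intro mult_strict_right_mono) auto
  moreover have "pi * theta_moment 1 x \<le> theta_moment 2 x"
    using theta_moment_le_Suc[OF x, of 1] by (simp add: numeral_2_eq_2)
  moreover have "1 * theta_moment 2 x \<le> x * theta_moment 2 x"
    using theta_moment_pos[OF x, of 2] assms by (intro mult_right_mono) auto
  ultimately show ?thesis using x by (auto intro!: mult_pos_pos)
qed

text \<open>
  The span of the functions \<open>x\<^sup>a \<Sum>\<^sub>n (\<pi>n\<^sup>2)\<^sup>k exp (- \<pi>n\<^sup>2x)\<close>. It contains \<open>M\<close> and \<open>x M\<close>, is closed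
  under the Euler operator \<open>x d/dx\<close>, and its members decay exponentially.
\<close>

inductive theta_comb :: "(real \<Rightarrow> real) \<Rightarrow> bool" where
  base: "theta_comb (\<lambda>x. x powr a * theta_moment k x)"
| add: "theta_comb f \<Longrightarrow> theta_comb g \<Longrightarrow> theta_comb (\<lambda>x. f x + g x)"
| scale: "theta_comb f \<Longrightarrow> theta_comb (\<lambda>x. c * f x)"

lemma theta_comb_euler_derivative:
  assumes "theta_comb f"
  obtains g where "theta_comb g" "\<And>x. x > 0 \<Longrightarrow> (f has_real_derivative g x / x) (at x)"
  using assms
proof (induction arbitrary: thesis rule: theta_comb.induct)
  case (base a k)
  have "((\<lambda>x. x powr a * theta_moment k x) has_real_derivative
      (a * (x powr a * theta_moment k x) + (- 1) * (x powr (a + 1) * theta_moment (Suc k) x)) / x)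
      (at x)" if "x > 0" for x
    using that has_real_derivative_theta_moment[OF that, of k]
    by (auto intro!: derivative_eq_intros simp: powr_add powr_diff field_simps)
  moreover have "theta_comb (\<lambda>x. a * (x powr a * theta_moment k x)
      + (- 1) * (x powr (a + 1) * theta_moment (Suc k) x))"
    by (intro theta_comb.intros)
  ultimately show ?case using base by blast
next
  case (add f g)
  obtain f' where f': "theta_comb f'" "\<And>x. x > 0 \<Longrightarrow> (f has_real_derivative f' x / x) (at x)"
    using add.IH(1) by blast
  obtain g' where g': "theta_comb g'" "\<And>x. x > 0 \<Longrightarrow> (g has_real_derivative g' x / x) (at x)"
    using add.IH(2) by blast
  show ?case
    by (rule add.prems[of "\<lambda>x. f' x + g' x"])
       (auto intro!: theta_comb.intros f' g' derivative_eq_intros simp: add_divide_distrib)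
next
  case (scale f c)
  obtain f' where f': "theta_comb f'" "\<And>x. x > 0 \<Longrightarrow> (f has_real_derivative f' x / x) (at x)"
    using scale.IH by blast
  show ?case
    by (rule scale.prems[of "\<lambda>x. c * f' x"])
       (auto intro!: theta_comb.intros f' derivative_eq_intros)
qed

lemma theta_comb_isCont:
  assumes "theta_comb f" "x > 0"
  shows "isCont f x"
  using theta_comb_euler_derivative[OF assms(1)] assms(2) DERIV_isCont by metis

lemma theta_comb_bound:
  assumes "theta_comb f"
  obtains C p where "C > 0" "p > 0" "\<And>x. x \<ge> 1 \<Longrightarrow> \<bar>f x\<bar> \<le> C * x powr p * exp (- pi * x)"
  using assms
proof (induction arbitrary: thesis rule: theta_comb.induct)
  case (base a k)
  show ?case
  proof (rule base[of "theta_moment k 1 * exp pi" "max a 1"])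
    fix x :: real assume x: "x \<ge> 1"
    have "\<bar>x powr a * theta_moment k x\<bar> = x powr a * theta_moment k x"
      using x theta_moment_pos[of x k] by simp
    also have "\<dots> \<le> x powr max a 1 * (theta_moment k 1 * exp pi * exp (- pi * x))"
      using x theta_moment_pos[of x k] by (intro mult_mono theta_moment_le_exp powr_mono) auto
    finally show "\<bar>x powr a * theta_moment k x\<bar>
        \<le> theta_moment k 1 * exp pi * x powr max a 1 * exp (- pi * x)"
      by (simp add: mult_ac)
  qed (auto intro!: mult_pos_pos theta_moment_pos)
next
  case (add f g)
  obtain C p where f: "C > 0" "p > 0" "\<And>x. x \<ge> 1 \<Longrightarrow> \<bar>f x\<bar> \<le> C * x powr p * exp (- pi * x)"
    using add.IH(1) by blast
  obtain D q where g: "D > 0" "q > 0" "\<And>x. x \<ge> 1 \<Longrightarrow> \<bar>g x\<bar> \<le> D * x powr q * exp (- pi * x)"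
    using add.IH(2) by blast
  show ?case
  proof (rule add.prems[of "C + D" "max p q"])
    fix x :: real assume x: "x \<ge> 1"
    have "\<bar>f x + g x\<bar> \<le> \<bar>f x\<bar> + \<bar>g x\<bar>" by simp
    also have "\<dots> \<le> C * x powr p * exp (- pi * x) + D * x powr q * exp (- pi * x)"
      using x by (intro add_mono f g)
    also have "\<dots> \<le> C * x powr max p q * exp (- pi * x) + D * x powr max p q * exp (- pi * x)"
      using x f g by (intro add_mono mult_mono powr_mono) auto
    finally show "\<bar>f x + g x\<bar> \<le> (C + D) * x powr max p q * exp (- pi * x)"
      by (simp add: algebra_simps)
  qed (use f g in auto)
next
  case (scale f c)
  obtain C p where f: "C > 0" "p > 0" "\<And>x. x \<ge> 1 \<Longrightarrow> \<bar>f x\<bar> \<le> C * x powr p * exp (- pi * x)"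
    using scale.IH by blast
  show ?case
  proof (rule scale.prems[of "(\<bar>c\<bar> + 1) * C" p])
    fix x :: real assume x: "x \<ge> 1"
    have "\<bar>c * f x\<bar> \<le> (\<bar>c\<bar> + 1) * (C * x powr p * exp (- pi * x))"
      unfolding abs_mult using x f by (intro mult_mono) auto
    then show "\<bar>c * f x\<bar> \<le> (\<bar>c\<bar> + 1) * C * x powr p * exp (- pi * x)"
      by (simp add: mult_ac)
  qed (use f in auto)
qed

lemma powr_le_exp_mult:
  fixes x s :: real
  assumes "x > 0" "s > 0"
  shows "x powr s \<le> exp (s * ln s) * exp x"
proof -
  have "ln (x / s) \<le> x / s - 1" using assms by (intro ln_le_minus_one) auto
  then have "s * ln (x / s) \<le> s * (x / s - 1)" using assms by (intro mult_left_mono) auto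
  then have "s * ln x \<le> s * ln s + x" using assms by (simp add: ln_div algebra_simps)
  then show ?thesis using assms unfolding exp_add [symmetric] by (simp add: powr_def)
qed

lemma set_integrable_exp_minus: "set_integrable lborel {1..} (\<lambda>x::real. exp (- x))"
proof -
  have "set_integrable lebesgue {1..} (\<lambda>x::real. exp (- x))"
    using integrable_on_exp_minus_to_infinity[of 1 1]
    by (intro nonnegative_absolutely_integrable_1) auto
  then show ?thesis
    unfolding set_integrable_def by (subst (asm) integrable_completion) auto
qed

lemma theta_comb_powr_bound:
  assumes "theta_comb f"
  obtains C p where "C > 0" "p > 0"
    "\<And>x r. x \<ge> 1 \<Longrightarrow> r \<ge> 0 \<Longrightarrow> \<bar>f x\<bar> * x powr r \<le> C * exp ((p + r) * ln (p + r)) * exp (- x)"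
proof -
  obtain C p where C: "C > 0" "p > 0" "\<And>x. x \<ge> 1 \<Longrightarrow> \<bar>f x\<bar> \<le> C * x powr p * exp (- pi * x)"
    using theta_comb_bound[OF assms] by blast
  have "\<bar>f x\<bar> * x powr r \<le> C * exp ((p + r) * ln (p + r)) * exp (- x)" if x: "x \<ge> 1" "r \<ge> 0" for x r
  proof -
    have "\<bar>f x\<bar> * x powr r \<le> (C * x powr p * exp (- pi * x)) * x powr r"
      using x by (intro mult_right_mono C) auto
    also have "\<dots> = C * (x powr (p + r) * exp (- pi * x))"
      by (simp add: powr_add mult_ac)
    also have "\<dots> \<le> C * ((exp ((p + r) * ln (p + r)) * exp x) * exp (- 2 * x))"
      using x C pi_ge_two by (intro mult_left_mono mult_mono powr_le_exp_mult) auto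
    also have "(exp ((p + r) * ln (p + r)) * exp x) * exp (- 2 * x)
        = exp ((p + r) * ln (p + r)) * exp (- x)"
      by (simp add: mult.assoc exp_add [symmetric])
    finally show ?thesis by (simp add: mult_ac)
  qed
  with C show ?thesis using that by blast
qed

lemma theta_comb_set_integrable:
  assumes "theta_comb f" "r \<ge> 0"
  shows "set_integrable lborel {1..} (\<lambda>x. f x * x powr r)"
proof -
  obtain C p where C: "C > 0" "p > 0"
    "\<And>x r. x \<ge> 1 \<Longrightarrow> r \<ge> 0 \<Longrightarrow> \<bar>f x\<bar> * x powr r \<le> C * exp ((p + r) * ln (p + r)) * exp (- x)"
    using theta_comb_powr_bound[OF assms(1)] by blast
  show ?thesis
  proof (rule set_integrable_bound[where f = "\<lambda>x. C * exp ((p + r) * ln (p + r)) * exp (- x)"])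
    show "set_integrable lborel {1..} (\<lambda>x. C * exp ((p + r) * ln (p + r)) * exp (- x))"
      by (intro set_integrable_mult_right set_integrable_exp_minus)
    have "continuous_on {1..} (\<lambda>x. f x * x powr r)"
      using theta_comb_isCont[OF assms(1)]
      by (intro continuous_intros continuous_at_imp_continuous_on) auto
    then show "set_borel_measurable lborel {1..} (\<lambda>x. f x * x powr r)"
      unfolding set_borel_measurable_def
      using borel_measurable_continuous_on_indicator[of "{1..}" "\<lambda>x. f x * x powr r"] by simp
    show "AE x in lborel. x \<in> {1..} \<longrightarrow> norm (f x * x powr r)
        \<le> norm (C * exp ((p + r) * ln (p + r)) * exp (- x))"
    proof (intro AE_I2 impI)
      fix x :: real assume "x \<in> {1..}"
      then show "norm (f x * x powr r) \<le> norm (C * exp ((p + r) * ln (p + r)) * exp (- x))"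
        using C(3)[of x r] assms(2) C(1) by (simp add: abs_mult)
    qed
  qed
qed

lemma theta_comb_tendsto_0:
  assumes "theta_comb f"
  shows "(f \<longlongrightarrow> 0) at_top"
proof -
  obtain C p where C: "C > 0" "p > 0"
    "\<And>x r. x \<ge> 1 \<Longrightarrow> r \<ge> 0 \<Longrightarrow> \<bar>f x\<bar> * x powr r \<le> C * exp ((p + r) * ln (p + r)) * exp (- x)"
    using theta_comb_powr_bound[OF assms(1)] by blast
  show ?thesis
  proof (rule Lim_null_comparison)
    have "((\<lambda>x::real. exp (- x)) \<longlongrightarrow> 0) at_top" by real_asymp
    then show "((\<lambda>x. C * exp (p * ln p) * exp (- x)) \<longlongrightarrow> 0) at_top"
      by (rule tendsto_mult_right_zero)
    show "\<forall>\<^sub>F x in at_top. norm (f x) \<le> C * exp (p * ln p) * exp (- x)"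
      using eventually_ge_at_top[of 1]
    proof eventually_elim
      case (elim x)
      then show ?case using C(3)[of x 0] by simp
    qed
  qed
qed


lemma isCont_theta_comb_oscillation:
  assumes "theta_comb G" "x > 0"
  shows "isCont (\<lambda>x. G x / x * sin (\<tau> * ln x)) x"
  using assms theta_comb_isCont[OF assms] by (intro continuous_intros) auto

lemma theta_comb_oscillation_integrable:
  assumes "theta_comb G"
  shows "set_integrable lborel {1..} (\<lambda>x. G x / x * sin (\<tau> * ln x))"
    and "\<bar>LBINT x:{1..}. G x / x * sin (\<tau> * ln x)\<bar> \<le> (LBINT x:{1..}. \<bar>G x\<bar>)"
proof -
  have int: "set_integrable lborel {1..} G"
    using theta_comb_set_integrable[OF assms, of 0]
    by (rule set_integrable_cong[THEN iffD1, rotated -1]) auto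
  have le: "norm (G x / x * sin (\<tau> * ln x)) \<le> norm (G x)" if "x \<ge> 1" for x
  proof -
    have "\<bar>G x\<bar> * \<bar>sin (\<tau> * ln x)\<bar> \<le> \<bar>G x\<bar> * x"
      using that abs_sin_le_one[of "\<tau> * ln x"] by (intro mult_left_mono) linarith+
    then show ?thesis using that by (simp add: abs_mult field_simps)
  qed
  have "continuous_on {1..} (\<lambda>x. G x / x * sin (\<tau> * ln x))"
    using isCont_theta_comb_oscillation[OF assms] by (intro continuous_at_imp_continuous_on) auto
  then have meas: "set_borel_measurable lborel {1..} (\<lambda>x. G x / x * sin (\<tau> * ln x))"
    unfolding set_borel_measurable_def
    using borel_measurable_continuous_on_indicator[of "{1..}" "\<lambda>x. G x / x * sin (\<tau> * ln x)"] by simp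
  show 1: "set_integrable lborel {1..} (\<lambda>x. G x / x * sin (\<tau> * ln x))"
    by (rule set_integrable_bound[OF int meas]) (use le in auto)
  have "norm (LBINT x:{1..}. G x / x * sin (\<tau> * ln x))
      \<le> (LBINT x:{1..}. norm (G x / x * sin (\<tau> * ln x)))"
    by (rule set_integral_norm_bound[OF 1])
  also have "\<dots> \<le> (LBINT x:{1..}. norm (G x))"
    using 1 int le by (intro set_integral_mono set_integrable_norm) auto
  finally show "\<bar>LBINT x:{1..}. G x / x * sin (\<tau> * ln x)\<bar> \<le> (LBINT x:{1..}. \<bar>G x\<bar>)"
    by simp
qed

text \<open>
  Two integrations by parts with respect to \<open>ln x\<close>; here \<open>K = (x d/dx)\<^sup>2 G\<close>.
\<close>

lemma theta_comb_oscillation: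
  assumes G: "theta_comb G"
  obtains K where "theta_comb K"
    "\<And>\<tau>. \<tau> \<noteq> 0 \<Longrightarrow> (LBINT x:{1..}. G x / x * sin (\<tau> * ln x))
      = G 1 / \<tau> - (LBINT x:{1..}. K x / x * sin (\<tau> * ln x)) / \<tau>\<^sup>2"
proof -
  obtain H where H: "theta_comb H" "\<And>x. x > 0 \<Longrightarrow> (G has_real_derivative H x / x) (at x)"
    using theta_comb_euler_derivative[OF G] by blast
  obtain K where K: "theta_comb K" "\<And>x. x > 0 \<Longrightarrow> (H has_real_derivative K x / x) (at x)"
    using theta_comb_euler_derivative[OF H(1)] by blast
  show ?thesis
  proof (rule that[OF K(1)])
    fix \<tau> :: real assume \<tau>: "\<tau> \<noteq> 0"
    define w where "w x = G x / x * sin (\<tau> * ln x) + K x / x * sin (\<tau> * ln x) / \<tau>\<^sup>2" for x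
    define W where "W x = H x * sin (\<tau> * ln x) / \<tau>\<^sup>2 - G x * cos (\<tau> * ln x) / \<tau>" for x
    have W: "(W has_real_derivative w x) (at x)" if "x > 0" for x
      unfolding W_def w_def using that \<tau> H(2)[OF that] K(2)[OF that]
      by (auto intro!: derivative_eq_intros simp: field_simps power2_eq_square)
    note iG = theta_comb_oscillation_integrable(1)[OF G, of \<tau>]
    note iK = theta_comb_oscillation_integrable(1)[OF K(1), of \<tau>]
    have iK': "set_integrable lborel {1..} (\<lambda>x. K x / x * sin (\<tau> * ln x) / \<tau>\<^sup>2)"
      by (intro set_integrable_divide iK)
    have iw: "set_integrable lborel {1..} w"
      unfolding w_def by (intro set_integral_add(1) iG iK')
    have "(LBINT x=1..\<infinity>. w x) = 0 - W 1"
    proof (rule interval_integral_FTC_integrable)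
      show "(W has_vector_derivative w x) (at x)" if "1 < ereal x" "ereal x < \<infinity>" for x
        using W[of x] that by (simp add: has_real_derivative_iff_has_vector_derivative one_ereal_def)
      show "isCont w x" if "1 < ereal x" "ereal x < \<infinity>" for x
      proof -
        have "x > 0" using that by (simp add: one_ereal_def)
        then show ?thesis
          unfolding w_def using \<tau>
          by (intro continuous_intros isCont_theta_comb_oscillation G K(1)) auto
      qed
      show "set_integrable lborel (einterval 1 \<infinity>) w"
        by (rule set_integrable_subset[OF iw]) (auto simp: einterval_def one_ereal_def)
      have "isCont W 1" using W[of 1] DERIV_isCont by simp
      then have "(W \<longlongrightarrow> W 1) (at_right 1)"
        using continuous_within filterlim_at_split isCont_def by blast
      then show "((W \<circ> real_of_ereal) \<longlongrightarrow> W 1) (at_right 1)"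
        by (simp add: ereal_tendsto_simps one_ereal_def)
      have "(W \<longlongrightarrow> 0) at_top"
      proof (rule Lim_null_comparison)
        show "((\<lambda>x. \<bar>H x\<bar> / \<tau>\<^sup>2 + \<bar>G x\<bar> / \<bar>\<tau>\<bar>) \<longlongrightarrow> 0) at_top"
          using tendsto_add[OF tendsto_divide_zero[OF tendsto_rabs_zero[OF theta_comb_tendsto_0[OF H(1)]]]
            tendsto_divide_zero[OF tendsto_rabs_zero[OF theta_comb_tendsto_0[OF G]]]] by simp
        have "norm (W x) \<le> \<bar>H x\<bar> / \<tau>\<^sup>2 + \<bar>G x\<bar> / \<bar>\<tau>\<bar>" for x
        proof -
          have "norm (W x) \<le> \<bar>H x * sin (\<tau> * ln x) / \<tau>\<^sup>2\<bar> + \<bar>G x * cos (\<tau> * ln x) / \<tau>\<bar>"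
            unfolding W_def real_norm_def by (rule abs_triangle_ineq4)
          also have "\<dots> \<le> \<bar>H x\<bar> / \<tau>\<^sup>2 + \<bar>G x\<bar> / \<bar>\<tau>\<bar>"
            unfolding abs_divide abs_mult power2_abs power_abs
            by (intro add_mono divide_right_mono mult_right_le_one_le) auto
          finally show ?thesis .
        qed
        then show "\<forall>\<^sub>F x in at_top. norm (W x) \<le> \<bar>H x\<bar> / \<tau>\<^sup>2 + \<bar>G x\<bar> / \<bar>\<tau>\<bar>" by simp
      qed
      then show "((W \<circ> real_of_ereal) \<longlongrightarrow> 0) (at_left \<infinity>)"
        by (simp add: ereal_tendsto_simps)
    qed simp
    also have "(LBINT x=1..\<infinity>. w x) = (LBINT x:{1<..}. w x)"
      by (simp add: interval_lebesgue_integral_def einterval_def one_ereal_def greaterThan_def)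
    also have "\<dots> = (LBINT x:{1..}. w x)"
    proof (unfold set_lebesgue_integral_def, rule integral_cong_AE)
      show "(\<lambda>x. indicat_real {1<..} x *\<^sub>R w x) \<in> borel_measurable lborel"
      proof -
        have "set_integrable lborel {1<..} w"
          by (rule set_integrable_subset[OF iw]) auto
        then show ?thesis
          unfolding set_integrable_def by (rule borel_measurable_integrable)
      qed
      show "(\<lambda>x. indicat_real {1..} x *\<^sub>R w x) \<in> borel_measurable lborel"
        using iw unfolding set_integrable_def by (auto dest: borel_measurable_integrable)
      show "AE x in lborel. indicat_real {1<..} x *\<^sub>R w x = indicat_real {1..} x *\<^sub>R w x"
        using AE_lborel_singleton[of "1::real"] by eventually_elim (auto simp: indicator_def)
    qed
    also have "\<dots> = (LBINT x:{1..}. G x / x * sin (\<tau> * ln x))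
        + (LBINT x:{1..}. K x / x * sin (\<tau> * ln x)) / \<tau>\<^sup>2"
      unfolding w_def set_integral_add(2)[OF iG iK'] set_integral_divide_zero ..
    finally show "(LBINT x:{1..}. G x / x * sin (\<tau> * ln x))
        = G 1 / \<tau> - (LBINT x:{1..}. K x / x * sin (\<tau> * ln x)) / \<tau>\<^sup>2"
      by (simp add: W_def)
  qed
qed

lemma theta_comb_oscillation_nonzero:
  assumes G: "theta_comb G" and "G 1 \<noteq> 0"
  obtains T where "\<And>\<tau>. \<bar>\<tau>\<bar> > T \<Longrightarrow> (LBINT x:{1..}. G x / x * sin (\<tau> * ln x)) \<noteq> 0"
proof -
  obtain K where K: "theta_comb K"
    "\<And>\<tau>. \<tau> \<noteq> 0 \<Longrightarrow> (LBINT x:{1..}. G x / x * sin (\<tau> * ln x))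
      = G 1 / \<tau> - (LBINT x:{1..}. K x / x * sin (\<tau> * ln x)) / \<tau>\<^sup>2"
    using theta_comb_oscillation[OF G] by blast
  define J where "J = (LBINT x:{1..}. \<bar>K x\<bar>)"
  show ?thesis
  proof (rule that[of "\<bar>J\<bar> / \<bar>G 1\<bar>"])
    fix \<tau> assume less: "\<bar>J\<bar> / \<bar>G 1\<bar> < \<bar>\<tau>\<bar>"
    moreover have "0 \<le> \<bar>J\<bar> / \<bar>G 1\<bar>" by simp
    ultimately have \<tau>: "\<tau> \<noteq> 0" by linarith
    show "(LBINT x:{1..}. G x / x * sin (\<tau> * ln x)) \<noteq> 0"
    proof
      assume "(LBINT x:{1..}. G x / x * sin (\<tau> * ln x)) = 0"
      then have "G 1 * \<tau> = (LBINT x:{1..}. K x / x * sin (\<tau> * ln x))"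
        using K(2)[OF \<tau>] \<tau> by (simp add: field_simps power2_eq_square)
      then have "\<bar>G 1\<bar> * \<bar>\<tau>\<bar> \<le> \<bar>J\<bar>"
        using theta_comb_oscillation_integrable(2)[OF K(1), of \<tau>]
        unfolding J_def abs_mult [symmetric] by linarith
      then show False using less assms(2) by (simp add: field_simps)
    qed
  qed
qed

subsection \<open>The tempered xi function\<close>

lemma exponential_integral_power_series:
  fixes f L :: "'a \<Rightarrow> real" and N :: "'a measure"
  assumes L [measurable]: "L \<in> borel_measurable N"
    and int: "\<And>r. r \<ge> 0 \<Longrightarrow> integrable N (\<lambda>x. f x * exp (r * \<bar>L x\<bar>))"
  shows "(\<lambda>n. (of_real (\<integral>x. f x * L x ^ n \<partial>N) / fact n) * w ^ n) sums
           (\<integral>x. of_real (f x) * exp (w * of_real (L x)) \<partial>N)" (is ?sums)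
    and "integrable N (\<lambda>x. of_real (f x) * exp (w * of_real (L x)) :: complex)" (is ?int)
proof -
  have f [measurable]: "f \<in> borel_measurable N"
    using borel_measurable_integrable[OF int[of 0]] by simp
  define g where "g n x = of_real (f x) * ((w * of_real (L x)) ^ n /\<^sub>R fact n)" for n x
  have ng: "norm (g n x) = \<bar>f x\<bar> * ((norm w * \<bar>L x\<bar>) ^ n /\<^sub>R fact n)" for n x
    by (simp add: g_def norm_mult norm_power norm_divide power_mult_distrib)
  have sm: "(\<lambda>n. norm (g n x)) sums (\<bar>f x\<bar> * exp (norm w * \<bar>L x\<bar>))" for x
    unfolding ng by (intro sums_mult exp_converges)
  have sg: "(\<lambda>n. g n x) sums (of_real (f x) * exp (w * of_real (L x)))" for x
    unfolding g_def by (intro sums_mult exp_converges)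
  have bnd: "(\<Sum>n<m. norm (g n x)) \<le> \<bar>f x\<bar> * exp (norm w * \<bar>L x\<bar>)" for m x
    using sum_le_suminf[of "\<lambda>n. norm (g n x)" "{..<m}"] sm[of x] by (simp add: sums_iff)
  have inte: "integrable N (\<lambda>x. \<bar>f x\<bar> * exp (norm w * \<bar>L x\<bar>))"
    using integrable_norm[OF int[of "norm w"]] by (simp add: abs_mult)
  have ig: "integrable N (g n)" for n
  proof (rule Bochner_Integration.integrable_bound[OF inte])
    show "g n \<in> borel_measurable N" unfolding g_def by measurable
    show "AE x in N. norm (g n x) \<le> norm (\<bar>f x\<bar> * exp (norm w * \<bar>L x\<bar>))"
    proof (rule AE_I2)
      fix x
      have "norm (g n x) \<le> (\<Sum>k<Suc n. norm (g k x))"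
        by (simp add: sum_nonneg)
      also have "\<dots> \<le> \<bar>f x\<bar> * exp (norm w * \<bar>L x\<bar>)" by (rule bnd)
      finally show "norm (g n x) \<le> norm (\<bar>f x\<bar> * exp (norm w * \<bar>L x\<bar>))" by simp
    qed
  qed
  have AE: "AE x in N. summable (\<lambda>n. norm (g n x))"
    using sm by (auto simp: sums_iff)
  have smi: "summable (\<lambda>n. \<integral>x. norm (g n x) \<partial>N)"
  proof (rule summableI_nonneg_bounded)
    fix m
    have "(\<Sum>n<m. \<integral>x. norm (g n x) \<partial>N) = (\<integral>x. (\<Sum>n<m. norm (g n x)) \<partial>N)"
      using ig by (subst Bochner_Integration.integral_sum) auto
    also have "\<dots> \<le> (\<integral>x. \<bar>f x\<bar> * exp (norm w * \<bar>L x\<bar>) \<partial>N)"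
      using ig inte bnd by (intro integral_mono) auto
    finally show "(\<Sum>n<m. \<integral>x. norm (g n x) \<partial>N) \<le> (\<integral>x. \<bar>f x\<bar> * exp (norm w * \<bar>L x\<bar>) \<partial>N)" .
  qed simp
  have sum_g: "(\<Sum>n. g n x) = of_real (f x) * exp (w * of_real (L x))" for x
    using sg[of x] by (simp add: sums_iff)
  show ?int
    using integrable_suminf[OF ig AE smi] by (simp add: sum_g)
  have "(\<integral>x. g n x \<partial>N) = (of_real (\<integral>x. f x * L x ^ n \<partial>N) / fact n) * w ^ n" for n
  proof -
    have "g n = (\<lambda>x. (w ^ n / fact n) * of_real (f x * L x ^ n))"
      by (simp add: fun_eq_iff g_def power_mult_distrib scaleR_conv_of_real divide_inverse mult_ac)
    then show ?thesis by (simp del: of_real_mult add: mult_ac)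
  qed
  then show ?sums
    using sums_integral[OF ig AE smi] by (simp add: sum_g)
qed

definition M_laplace :: "complex \<Rightarrow> complex" where
  "M_laplace w = (\<integral>x. of_real (indicator {1..} x * M x) * exp (w * of_real (ln x / 2)) \<partial>lborel)"

lemma theta_comb_M:
  "theta_comb (\<lambda>x. x powr (5 / 4) * theta_moment 2 x + (- 3 / 2) * (x powr (1 / 4) * theta_moment 1 x))"
  by (intro theta_comb.intros)

lemma set_integrable_M_powr:
  assumes "r \<ge> 0"
  shows "set_integrable lborel {1..} (\<lambda>x. M x * x powr r)"
  using theta_comb_set_integrable[OF theta_comb_M assms]
  by (rule set_integrable_cong[THEN iffD1, rotated -1]) (auto simp: M_eq_theta_moment)

lemma integrable_M_exp:
  assumes "r \<ge> 0"
  shows "integrable lborel (\<lambda>x. indicator {1..} x * M x * exp (r * \<bar>ln x / 2\<bar>))"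
proof -
  have "integrable lborel (\<lambda>x. indicator {1..} x *\<^sub>R (M x * x powr (r / 2)))"
    using set_integrable_M_powr[of "r / 2"] assms by (simp add: set_integrable_def)
  also have "(\<lambda>x. indicator {1..} x *\<^sub>R (M x * x powr (r / 2)))
      = (\<lambda>x. indicator {1..} x * M x * exp (r * \<bar>ln x / 2\<bar>))"
    by (auto simp: fun_eq_iff indicator_def powr_def)
  finally show ?thesis .
qed

lemma M_laplace_power_series:
    "(\<lambda>n. (of_real (\<integral>x. indicator {1..} x * M x * (ln x / 2) ^ n \<partial>lborel) / fact n) * w ^ n)
       sums M_laplace w"
  and M_laplace_integrable:
    "integrable lborel (\<lambda>x. complex_of_real (indicator {1..} x * M x) * exp (w * complex_of_real (ln x / 2)))"
  using exponential_integral_power_series[where N = lborel and L = "\<lambda>x. ln x / 2"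
    and f = "\<lambda>x. indicator {1..} x * M x", OF _ integrable_M_exp]
  unfolding M_laplace_def by measurable

lemma tempered_xi_eq_M_laplace:
  "tempered_xi (1 / 2 + w) = 2 * (M_laplace w - M_laplace (- w))"
proof -
  have "M_laplace w - M_laplace (- w) =
      (\<integral>x. of_real (indicator {1..} x * M x) * exp (w * of_real (ln x / 2))
         - of_real (indicator {1..} x * M x) * exp (- w * of_real (ln x / 2)) \<partial>lborel)"
    unfolding M_laplace_def by (rule Bochner_Integration.integral_diff [symmetric])
      (use M_laplace_integrable in blast)+
  also have "\<dots> = (\<integral>x. 2 * (indicator {1..} x *\<^sub>R
      (complex_of_real (M x) * sinh (1 / 2 * w * complex_of_real (ln x)))) \<partial>lborel)"
    by (intro Bochner_Integration.integral_cong)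
       (auto simp: sinh_field_def indicator_def field_simps)
  also have "\<dots> = 2 * (LBINT x:{1..}. complex_of_real (M x) * sinh (1 / 2 * w * complex_of_real (ln x)))"
    unfolding set_lebesgue_integral_def by (rule integral_mult_right_zero)
  finally show ?thesis by (simp add: tempered_xi_def)
qed

lemma M_laplace_has_field_derivative_ex: "\<exists>d. (M_laplace has_field_derivative d) (at w)"
  and M_laplace_has_field_derivative_0: "(M_laplace has_field_derivative
    of_real (\<integral>x. indicator {1..} x * M x * (ln x / 2) \<partial>lborel)) (at 0)"
proof -
  define c :: "nat \<Rightarrow> complex" where
    "c n = of_real (\<integral>x. indicator {1..} x * M x * (ln x / 2) ^ n \<partial>lborel) / fact n" for n
  have c: "(\<lambda>n. c n * w ^ n) sums M_laplace w" for w
    unfolding c_def by (rule M_laplace_power_series)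
  then have sm: "summable (\<lambda>n. c n * w ^ n)" for w
    by (simp add: sums_iff)
  have eq: "M_laplace = (\<lambda>w. \<Sum>n. c n * w ^ n)"
    using c by (simp add: sums_iff fun_eq_iff)
  note d = termdiffs_strong_converges_everywhere[OF sm, folded eq]
  show "\<exists>d. (M_laplace has_field_derivative d) (at w)"
    using d by blast
  have "(\<Sum>n. diffs c n * 0 ^ n) = c 1"
    by (simp add: diffs_def)
  also have "c 1 = of_real (\<integral>x. indicator {1..} x * M x * (ln x / 2) \<partial>lborel)"
    unfolding c_def by simp
  finally show "(M_laplace has_field_derivative
      of_real (\<integral>x. indicator {1..} x * M x * (ln x / 2) \<partial>lborel)) (at 0)"
    using d[of 0] by (rule DERIV_cong[rotated])
qed

lemma M_laplace_holomorphic: "M_laplace holomorphic_on S"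
  using M_laplace_has_field_derivative_ex
  by (meson field_differentiable_at_within field_differentiable_def holomorphic_on_def)

lemma tempered_xi_eq:
  "tempered_xi = (\<lambda>s. 2 * (M_laplace (s - 1 / 2) - M_laplace (1 / 2 - s)))"
  using tempered_xi_eq_M_laplace[of "s - 1 / 2" for s] by (simp add: fun_eq_iff)

lemma tempered_xi_holomorphic: "tempered_xi holomorphic_on S"
  unfolding tempered_xi_eq
  by (intro holomorphic_intros holomorphic_on_compose_gen[OF _ M_laplace_holomorphic, unfolded o_def])
     auto

lemma integrable_M_mult:
  assumes [measurable]: "\<phi> \<in> borel_measurable borel"
    and r: "r \<ge> 0" "\<And>x. x \<ge> 1 \<Longrightarrow> \<bar>\<phi> x\<bar> \<le> exp (r * \<bar>ln x / 2\<bar>)"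
  shows "integrable lborel (\<lambda>x. indicator {1..} x * M x * \<phi> x)"
proof (rule Bochner_Integration.integrable_bound[OF integrable_M_exp[OF r(1)]])
  have [measurable]: "(\<lambda>x. indicator {1..} x * M x) \<in> borel_measurable lborel"
    using borel_measurable_integrable[OF integrable_M_exp[of 0]] by simp
  show "(\<lambda>x. indicator {1..} x * M x * \<phi> x) \<in> borel_measurable lborel"
    by measurable
  show "AE x in lborel. norm (indicator {1..} x * M x * \<phi> x)
      \<le> norm (indicator {1..} x * M x * exp (r * \<bar>ln x / 2\<bar>))"
    using r(2) by (intro AE_I2) (auto simp: indicator_def abs_mult intro!: mult_left_mono)
qed

lemma M_integral_lower_bound:
  assumes X: "X \<ge> 1"
  obtains m where "m > 0"
    "\<And>\<phi> c. integrable lborel (\<lambda>x. indicator {1..} x * M x * \<phi> x) \<Longrightarrow> \<forall>x\<ge>1. \<phi> x \<ge> 0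
      \<Longrightarrow> \<forall>x\<ge>X. \<phi> x \<ge> c \<Longrightarrow> c \<ge> 0
      \<Longrightarrow> m * c \<le> (\<integral>x. indicator {1..} x * M x * \<phi> x \<partial>lborel)"
proof -
  have "continuous_on {X..X+1} M"
  proof (rule continuous_on_eq)
    show "continuous_on {X..X+1} (\<lambda>x. x powr (5 / 4) * theta_moment 2 x
        + (- 3 / 2) * (x powr (1 / 4) * theta_moment 1 x))"
      using X by (intro continuous_at_imp_continuous_on ballI theta_comb_isCont[OF theta_comb_M]) auto
  qed (use X in \<open>auto simp: M_eq_theta_moment\<close>)
  then obtain x0 where x0: "x0 \<in> {X..X+1}" "\<And>x. x \<in> {X..X+1} \<Longrightarrow> M x0 \<le> M x"
    using continuous_attains_inf[of "{X..X+1}" M] by auto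
  show ?thesis
  proof (rule that[of "M x0"])
    show "M x0 > 0" using x0(1) X by (intro M_pos) auto
    fix \<phi> :: "real \<Rightarrow> real" and c
    assume int: "integrable lborel (\<lambda>x. indicator {1..} x * M x * \<phi> x)"
      and nonneg: "\<forall>x\<ge>1. \<phi> x \<ge> 0" and ge: "\<forall>x\<ge>X. \<phi> x \<ge> c" and c: "c \<ge> 0"
    have "M x0 * c = (\<integral>x. indicator {X..X+1} x * (M x0 * c) \<partial>lborel)"
      by simp
    also have "\<dots> \<le> (\<integral>x. indicator {1..} x * M x * \<phi> x \<partial>lborel)"
    proof (rule integral_mono[OF _ int])
      show "integrable lborel (\<lambda>x. indicator {X..X+1} x * (M x0 * c))"
        by simp
      fix x :: real
      show "indicator {X..X+1} x * (M x0 * c) \<le> indicator {1..} x * M x * \<phi> x"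
      proof (cases "x \<in> {X..X+1}")
        case True
        then have "M x0 * c \<le> M x * \<phi> x"
          using x0(2)[OF True] ge c M_pos[of x] X by (intro mult_mono) auto
        then show ?thesis using True X by simp
      next
        case False
        then show ?thesis using nonneg M_pos[of x] by (auto simp: indicator_def)
      qed
    qed
    finally show "M x0 * c \<le> (\<integral>x. indicator {1..} x * M x * \<phi> x \<partial>lborel)" .
  qed
qed

lemma tempered_xi_half: "tempered_xi (1 / 2) = 0"
  using tempered_xi_eq_M_laplace[of 0] by simp

lemma deriv_tempered_xi_half: "deriv tempered_xi (1 / 2) \<noteq> 0"
proof -
  define d where "d = (\<integral>x. indicator {1..} x * M x * (ln x / 2) \<partial>lborel)"
  have "d > 0"
  proof -
    obtain m where m: "m > 0"
      "\<And>\<phi> c. integrable lborel (\<lambda>x. indicator {1..} x * M x * \<phi> x) \<Longrightarrow> \<forall>x\<ge>1. \<phi> x \<ge> 0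
      \<Longrightarrow> \<forall>x\<ge>2. \<phi> x \<ge> c \<Longrightarrow> c \<ge> 0
      \<Longrightarrow> m * c \<le> (\<integral>x. indicator {1..} x * M x * \<phi> x \<partial>lborel)"
      by (rule M_integral_lower_bound[of 2], simp) blast
    have "integrable lborel (\<lambda>x. indicator {1..} x * M x * (ln x / 2))"
    proof (rule integrable_M_mult[of _ 1])
      show "\<bar>ln x / 2\<bar> \<le> exp (1 * \<bar>ln x / 2\<bar>)" for x :: real
        using exp_ge_add_one_self[of "\<bar>ln x / 2\<bar>"] unfolding mult_1 by linarith
    qed auto
    then have "m * (ln 2 / 2) \<le> d"
      unfolding d_def by (intro m(2)) auto
    moreover have "m * (ln 2 / 2) > 0" using m(1) by simp
    ultimately show ?thesis by linarith
  qed
  have "(tempered_xi has_field_derivative 2 * (of_real d * 1 - of_real d * (- 1))) (at (1 / 2))"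
    unfolding tempered_xi_eq
    by (intro DERIV_cmult DERIV_diff DERIV_chain2[where f = M_laplace])
       (auto intro!: derivative_eq_intros M_laplace_has_field_derivative_0[folded d_def])
  then have "deriv tempered_xi (1 / 2) = 4 * of_real d"
    by (simp add: DERIV_imp_deriv)
  then show ?thesis using \<open>d > 0\<close> by simp
qed

lemma simple_zero_tempered_xi: "simple_zero tempered_xi (1 / 2)"
proof -
  have "zorder tempered_xi (1 / 2) = 1"
    by (rule zorder_zero_eqI[OF tempered_xi_holomorphic open_UNIV])
       (auto simp: tempered_xi_half deriv_tempered_xi_half)
  moreover have "tempered_xi analytic_on {1 / 2}"
    using tempered_xi_holomorphic[of UNIV] analytic_on_holomorphic by blast
  ultimately show ?thesis by (simp add: simple_zero_def tempered_xi_half)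
qed

lemma not_constant_tempered_xi: "\<not> tempered_xi constant_on UNIV"
proof
  assume "tempered_xi constant_on UNIV"
  then obtain c where "tempered_xi = (\<lambda>_. c)" by (auto simp: constant_on_def)
  then show False using deriv_tempered_xi_half deriv_const by metis
qed

lemma tempered_xi_critical_line:
  "tempered_xi (Complex (1 / 2) t) = 4 * \<i> * of_real (LBINT x:{1..}. M x * sin (t / 2 * ln x))"
proof -
  have "sinh (1 / 2 * (Complex (1 / 2) t - 1 / 2) * complex_of_real (ln x))
      = \<i> * of_real (sin (t / 2 * ln x))" for x
  proof -
    have "1 / 2 * (Complex (1 / 2) t - 1 / 2) * complex_of_real (ln x) = \<i> * of_real (t / 2 * ln x)"
      by (simp add: complex_eq_iff)
    also have "sinh \<dots> = \<i> * sin (of_real (t / 2 * ln x))"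
      by (simp add: sinh_conv_sin)
    finally show ?thesis by (simp only: sin_of_real)
  qed
  then have "tempered_xi (Complex (1 / 2) t) = 4 * (LBINT x:{1..}. \<i> * of_real (M x * sin (t / 2 * ln x)))"
    by (simp add: tempered_xi_def mult_ac)
  also have "\<dots> = 4 * \<i> * of_real (LBINT x:{1..}. M x * sin (t / 2 * ln x))"
    by (simp only: set_integral_mult_right set_integral_complex_of_real mult.assoc)
  finally show ?thesis .
qed

lemma tempered_xi_critical_line_nonzero:
  obtains T where "\<And>t. \<bar>t\<bar> > T \<Longrightarrow> tempered_xi (Complex (1 / 2) t) \<noteq> 0"
proof -
  define G where "G x = x powr (9 / 4) * theta_moment 2 x
      + (- 3 / 2) * (x powr (5 / 4) * theta_moment 1 x)" for x
  have G: "theta_comb G"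
    unfolding G_def by (intro theta_comb.intros)
  have GM: "G x / x = M x" if "x > 0" for x
  proof -
    have "G x = (x * x powr (5 / 4)) * theta_moment 2 x
        + (- 3 / 2) * ((x * x powr (1 / 4)) * theta_moment 1 x)"
      using that powr_mult_base[of x "5 / 4"] powr_mult_base[of x "1 / 4"] by (simp add: G_def)
    also have "\<dots> = x * M x"
      unfolding M_eq_theta_moment[OF that] by (simp only: algebra_simps)
    finally show ?thesis using that by simp
  qed
  have "G 1 \<noteq> 0" using GM[of 1] M_pos[of 1] by simp
  then obtain T where T: "\<And>\<tau>. \<bar>\<tau>\<bar> > T \<Longrightarrow> (LBINT x:{1..}. G x / x * sin (\<tau> * ln x)) \<noteq> 0"
    using theta_comb_oscillation_nonzero[OF G] by blast
  have "(LBINT x:{1..}. G x / x * sin (\<tau> * ln x)) = (LBINT x:{1..}. M x * sin (\<tau> * ln x))" for \<tau>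
    by (rule set_lebesgue_integral_cong) (auto simp: GM)
  with T have T: "\<And>\<tau>. \<bar>\<tau>\<bar> > T \<Longrightarrow> (LBINT x:{1..}. M x * sin (\<tau> * ln x)) \<noteq> 0"
    by simp
  show ?thesis
  proof (rule that[of "2 * T"])
    fix t :: real assume "2 * T < \<bar>t\<bar>"
    then have "(LBINT x:{1..}. M x * sin (t / 2 * ln x)) \<noteq> 0" by (intro T) simp
    then show "tempered_xi (Complex (1 / 2) t) \<noteq> 0"
      unfolding tempered_xi_critical_line mult_eq_0_iff of_real_eq_0_iff by simp
  qed
qed

lemma finite_critical_zeros: "finite {s. tempered_xi s = 0 \<and> Re s = 1 / 2}"
proof -
  obtain T where T: "\<And>t. \<bar>t\<bar> > T \<Longrightarrow> tempered_xi (Complex (1 / 2) t) \<noteq> 0"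
    using tempered_xi_critical_line_nonzero by blast
  have "finite {s \<in> cball 0 (1 / 2 + T). tempered_xi s = 0}"
    by (rule holomorphic_compact_finite_zeros[OF tempered_xi_holomorphic open_UNIV connected_UNIV])
       (auto simp: not_constant_tempered_xi)
  moreover have "{s. tempered_xi s = 0 \<and> Re s = 1 / 2} \<subseteq> {s \<in> cball 0 (1 / 2 + T). tempered_xi s = 0}"
  proof clarify
    fix s assume s: "tempered_xi s = 0" "Re s = 1 / 2"
    then have "s = Complex (1 / 2) (Im s)" by (simp add: complex_eq_iff)
    then have "\<bar>Im s\<bar> \<le> T" using T[of "Im s"] s(1) by (metis not_le)
    then show "s \<in> cball 0 (1 / 2 + T)"
      using cmod_le[of s] s(2) by simp
  qed
  ultimately show ?thesis by (rule finite_subset[rotated])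
qed

lemma norm_M_laplace_le:
  obtains C p where "C > 0" "p > 0"
    "\<And>w. norm (M_laplace w) \<le> C * exp ((p + norm w / 2) * ln (p + norm w / 2))"
proof -
  obtain C p where C: "C > 0" "p > 0"
    "\<And>x r. x \<ge> 1 \<Longrightarrow> r \<ge> 0 \<Longrightarrow> \<bar>M x\<bar> * x powr r \<le> C * exp ((p + r) * ln (p + r)) * exp (- x)"
  proof (rule theta_comb_powr_bound[OF theta_comb_M], goal_cases)
    case (1 C p)
    show ?case by (rule 1(1)[OF 1(2,3)]) (use 1(4) in \<open>simp add: M_eq_theta_moment\<close>)
  qed
  define I :: real where "I = (LBINT x:{1..}. exp (- x))"
  have "norm (M_laplace w) \<le> C * \<bar>I\<bar> * exp ((p + norm w / 2) * ln (p + norm w / 2))" for w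
  proof -
    define B where "B = C * exp ((p + norm w / 2) * ln (p + norm w / 2))"
    have "norm (M_laplace w) \<le> (\<integral>x. indicator {1..} x * (B * exp (- x)) \<partial>lborel)"
      unfolding M_laplace_def
    proof (rule Bochner_Integration.integral_norm_bound_integral)
      show "integrable lborel (\<lambda>x. indicator {1..} x * (B * exp (- x)))"
        using set_integrable_mult_right[OF set_integrable_exp_minus, of B] by (simp add: set_integrable_def)
      show "integrable lborel (\<lambda>x. complex_of_real (indicator {1..} x * M x) * exp (w * complex_of_real (ln x / 2)))"
        by (rule M_laplace_integrable)
      fix x :: real
      show "norm (complex_of_real (indicator {1..} x * M x) * exp (w * complex_of_real (ln x / 2)))
          \<le> indicator {1..} x * (B * exp (- x))"
      proof (cases "x \<ge> 1")
        case True
        have "norm (exp (w * complex_of_real (ln x / 2))) \<le> exp (norm (w * complex_of_real (ln x / 2)))"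
          by (rule norm_exp)
        also have "\<dots> = x powr (norm w / 2)"
          using True by (simp add: powr_def norm_mult)
        finally have "\<bar>M x\<bar> * norm (exp (w * complex_of_real (ln x / 2))) \<le> \<bar>M x\<bar> * x powr (norm w / 2)"
          by (intro mult_left_mono) auto
        also have "\<dots> \<le> B * exp (- x)"
          unfolding B_def using True by (intro C(3)) auto
        finally show ?thesis using True by (simp add: norm_mult)
      qed simp
    qed
    also have "\<dots> = B * I"
      by (simp add: I_def set_lebesgue_integral_def mult_ac)
    also have "\<dots> \<le> B * \<bar>I\<bar>" using C(1) by (intro mult_left_mono) (auto simp: B_def)
    finally show ?thesis by (simp add: B_def mult_ac)
  qed
  also have "C * \<bar>I\<bar> * exp y \<le> C * (\<bar>I\<bar> + 1) * exp y" for y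
    using C(1) by (intro mult_right_mono mult_left_mono) auto
  finally show ?thesis
    using C by (intro that[of "C * (\<bar>I\<bar> + 1)" p]) auto
qed

lemma norm_tempered_xi_le:
  obtains D where "\<And>w. norm (tempered_xi (1 / 2 + w)) \<le> exp (D * (1 + norm w) powr (3 / 2))"
proof -
  obtain C p where C: "C > 0" "p > 0"
    "\<And>w. norm (M_laplace w) \<le> C * exp ((p + norm w / 2) * ln (p + norm w / 2))"
    using norm_M_laplace_le by blast
  show ?thesis
  proof (rule that[of "\<bar>ln (4 * C)\<bar> + 2 * (p + 1) powr (3 / 2)"])
    fix w :: complex
    define y where "y = 1 + norm w"
    define a where "a = p + norm w / 2"
    define b where "b = (p + 1) * y"
    have y: "y \<ge> 1" by (simp add: y_def)
    have a: "a > 0" using C(2) by (simp add: a_def add_pos_nonneg)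
    have ab: "a \<le> b" using C(2) by (simp add: a_def b_def y_def algebra_simps)
    have b: "b > 0" using a ab by linarith
    have "a * ln a \<le> b * (2 * b powr (1 / 2))"
    proof -
      have "ln a \<le> ln b" using a ab by simp
      also have "ln b = 2 * ln (b powr (1 / 2))" using b by (simp add: ln_powr)
      also have "\<dots> \<le> 2 * b powr (1 / 2)"
        using ln_le_minus_one[of "b powr (1 / 2)"] b by simp
      finally have "a * ln a \<le> a * (2 * b powr (1 / 2))" using a by (intro mult_left_mono) auto
      also have "\<dots> \<le> b * (2 * b powr (1 / 2))" using ab by (intro mult_right_mono) auto
      finally show ?thesis .
    qed
    also have "\<dots> = 2 * b powr (3 / 2)"
      using powr_mult_base[of b "1 / 2"] b by simp
    also have "\<dots> = 2 * (p + 1) powr (3 / 2) * y powr (3 / 2)"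
      unfolding b_def using C(2) y by (subst powr_mult) auto
    finally have a_ln: "a * ln a \<le> 2 * (p + 1) powr (3 / 2) * y powr (3 / 2)" .
    have "ln (4 * C) \<le> \<bar>ln (4 * C)\<bar> * 1" by simp
    also have "\<dots> \<le> \<bar>ln (4 * C)\<bar> * y powr (3 / 2)"
      using y by (intro mult_left_mono ge_one_powr_ge_zero) auto
    finally have lnC: "ln (4 * C) \<le> \<bar>ln (4 * C)\<bar> * y powr (3 / 2)" .
    have "norm (tempered_xi (1 / 2 + w)) \<le> 2 * (norm (M_laplace w) + norm (M_laplace (- w)))"
      unfolding tempered_xi_eq_M_laplace norm_mult norm_numeral
      by (intro mult_left_mono norm_triangle_ineq4) simp
    also have "\<dots> \<le> 4 * C * exp (a * ln a)"
      using C(3)[of w] C(3)[of "- w"] by (simp add: a_def)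
    also have "4 * C = exp (ln (4 * C))" using C(1) by simp
    also have "\<dots> * exp (a * ln a) = exp (ln (4 * C) + a * ln a)" by (simp only: exp_add)
    also have "\<dots> \<le> exp ((\<bar>ln (4 * C)\<bar> + 2 * (p + 1) powr (3 / 2)) * y powr (3 / 2))"
      using a_ln lnC unfolding exp_le_cancel_iff distrib_right by linarith
    finally show "norm (tempered_xi (1 / 2 + w))
        \<le> exp ((\<bar>ln (4 * C)\<bar> + 2 * (p + 1) powr (3 / 2)) * (1 + norm w) powr (3 / 2))"
      by (simp add: y_def)
  qed
qed

lemma tempered_xi_real_axis:
  "tempered_xi (1 / 2 + of_real \<sigma>)
     = of_real (4 * (\<integral>x. indicator {1..} x * M x * sinh (\<sigma> * (ln x / 2)) \<partial>lborel))"
proof -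
  have "sinh (1 / 2 * (1 / 2 + of_real \<sigma> - 1 / 2) * complex_of_real (ln x))
      = of_real (sinh (\<sigma> * (ln x / 2)))" for x
  proof -
    have "1 / 2 * (1 / 2 + of_real \<sigma> - 1 / 2) * complex_of_real (ln x) = of_real (\<sigma> * (ln x / 2))"
      by simp
    then show ?thesis
      by (simp only: sinh_field_def of_real_diff of_real_divide of_real_numeral exp_of_real
            of_real_minus [symmetric])
  qed
  then have "tempered_xi (1 / 2 + of_real \<sigma>)
      = 4 * (LBINT x:{1..}. complex_of_real (M x * sinh (\<sigma> * (ln x / 2))))"
    by (simp add: tempered_xi_def)
  also have "\<dots> = of_real (4 * (LBINT x:{1..}. M x * sinh (\<sigma> * (ln x / 2))))"
    unfolding set_integral_complex_of_real by simp
  finally show ?thesis by (simp add: set_lebesgue_integral_def mult.assoc)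
qed

lemma tempered_xi_real_axis_ge:
  assumes "c \<ge> 0"
  obtains m where "m > 0" "\<And>\<sigma>. \<sigma> \<ge> 0 \<Longrightarrow> norm (tempered_xi (1 / 2 + of_real \<sigma>)) \<ge> m * sinh (\<sigma> * c)"
proof -
  obtain m where m: "m > 0"
    "\<And>\<phi> k. integrable lborel (\<lambda>x. indicator {1..} x * M x * \<phi> x) \<Longrightarrow> \<forall>x\<ge>1. \<phi> x \<ge> 0
      \<Longrightarrow> \<forall>x\<ge>exp (2 * c). \<phi> x \<ge> k \<Longrightarrow> k \<ge> 0
      \<Longrightarrow> m * k \<le> (\<integral>x. indicator {1..} x * M x * \<phi> x \<partial>lborel)"
    by (rule M_integral_lower_bound[of "exp (2 * c)"], use assms in simp) blast
  have "m * sinh (\<sigma> * c) \<le> norm (tempered_xi (1 / 2 + of_real \<sigma>))" if \<sigma>: "\<sigma> \<ge> 0" for \<sigma>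
  proof -
    have "m * sinh (\<sigma> * c) \<le> (\<integral>x. indicator {1..} x * M x * sinh (\<sigma> * (ln x / 2)) \<partial>lborel)"
    proof (rule m(2))
      show "integrable lborel (\<lambda>x. indicator {1..} x * M x * sinh (\<sigma> * (ln x / 2)))"
      proof (rule integrable_M_mult[OF _ \<sigma>])
        fix x :: real assume "x \<ge> 1"
        then have "0 \<le> \<sigma> * (ln x / 2)" using \<sigma> by simp
        moreover have "sinh y \<le> exp y" for y :: real
        proof -
          have "- exp (- y) \<le> exp y" by (rule order_trans[of _ 0]) simp_all
          then show ?thesis by (simp add: sinh_field_def)
        qed
        ultimately show "\<bar>sinh (\<sigma> * (ln x / 2))\<bar> \<le> exp (\<sigma> * \<bar>ln x / 2\<bar>)"
          using \<open>x \<ge> 1\<close> by simp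
      qed (simp add: sinh_field_def)
      show "\<forall>x\<ge>1. sinh (\<sigma> * (ln x / 2)) \<ge> 0"
        using \<sigma> by simp
      show "\<forall>x\<ge>exp (2 * c). sinh (\<sigma> * c) \<le> sinh (\<sigma> * (ln x / 2))"
      proof (intro allI impI)
        fix x assume that: "x \<ge> exp (2 * c)"
        have "x > 0" using that exp_gt_zero[of "2 * c"] by linarith
        then have "2 * c \<le> ln x" using that by (simp add: ln_ge_iff)
        then have "\<sigma> * c \<le> \<sigma> * (ln x / 2)" using \<sigma> by (intro mult_left_mono) auto
        then show "sinh (\<sigma> * c) \<le> sinh (\<sigma> * (ln x / 2))"
          by (simp only: sinh_real_le_iff)
      qed
    qed (use \<sigma> assms in simp)
    moreover have "m * sinh (\<sigma> * c) \<ge> 0" using m(1) \<sigma> assms by simp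
    ultimately show ?thesis unfolding tempered_xi_real_axis norm_of_real by linarith
  qed
  with m(1) show ?thesis by (rule that)
qed

lemma infinite_zeros_tempered_xi: "infinite {s. tempered_xi s = 0}"
proof
  assume "finite {s. tempered_xi s = 0}"
  then have "finite ((\<lambda>s. s - 1 / 2) ` {s. tempered_xi s = 0})" by simp
  also have "(\<lambda>s. s - 1 / 2) ` {s. tempered_xi s = 0} = {w. tempered_xi (1 / 2 + w) = 0}"
    by (auto simp: image_iff intro!: exI[of _ "1 / 2 + w" for w])
  finally have fin: "finite {w. tempered_xi (1 / 2 + w) = 0}" .
  have hol: "(\<lambda>w. tempered_xi (1 / 2 + w)) holomorphic_on UNIV"
    by (intro holomorphic_on_compose_gen[OF _ tempered_xi_holomorphic[of UNIV], unfolded o_def]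
          holomorphic_intros) auto
  obtain D where "\<And>w. norm (tempered_xi (1 / 2 + w)) \<le> exp (D * (1 + norm w) powr (3 / 2))"
    using norm_tempered_xi_le by blast
  then obtain A c where A: "\<And>w. norm (tempered_xi (1 / 2 + w)) \<le> A * exp (c * norm w)"
    using entire_finite_zeros_imp_exponential_type[OF hol fin] by blast
  obtain m where m: "m > 0"
    "\<And>\<sigma>. \<sigma> \<ge> 0 \<Longrightarrow> norm (tempered_xi (1 / 2 + of_real \<sigma>)) \<ge> m * sinh (\<sigma> * (\<bar>c\<bar> + 1))"
    using tempered_xi_real_axis_ge[of "\<bar>c\<bar> + 1"] by auto
  define \<sigma> where "\<sigma> = 2 * \<bar>A\<bar> / m + 1"
  have \<sigma>: "\<sigma> > 0" using m(1) by (simp add: \<sigma>_def add_nonneg_pos)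
  define E where "E = exp (\<bar>c\<bar> * \<sigma>)"
  have E: "E \<ge> 1" using \<sigma> by (simp add: E_def)
  have "\<sigma> \<le> exp \<sigma> - 1"
    using exp_ge_add_one_self[of \<sigma>] by linarith
  then have "\<sigma> * E \<le> (exp \<sigma> - 1) * E"
    using E by (intro mult_right_mono) auto
  also have "\<dots> = exp (\<sigma> * (\<bar>c\<bar> + 1)) - E"
    by (simp add: E_def algebra_simps exp_add)
  also have "\<dots> \<le> 2 * sinh (\<sigma> * (\<bar>c\<bar> + 1))"
  proof -
    have "exp (- (\<sigma> * (\<bar>c\<bar> + 1))) \<le> 1" using \<sigma> by simp
    also note E
    finally show ?thesis by (simp add: sinh_field_def)
  qed
  finally have "m * (\<sigma> * E) \<le> m * (2 * sinh (\<sigma> * (\<bar>c\<bar> + 1)))"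
    using m(1) by (intro mult_left_mono) auto
  also have "\<dots> \<le> 2 * (A * exp (c * \<sigma>))"
    using m(2)[of \<sigma>] A[of "of_real \<sigma>"] \<sigma> by simp
  also have "\<dots> \<le> 2 * (\<bar>A\<bar> * E)"
    unfolding E_def using \<sigma> by (intro mult_left_mono mult_mono) auto
  finally have "m * \<sigma> * E \<le> (2 * \<bar>A\<bar>) * E" by (simp add: mult_ac)
  then have "m * \<sigma> \<le> 2 * \<bar>A\<bar>" using E by simp
  then show False using m(1) by (simp add: \<sigma>_def algebra_simps)
qed

theorem theorem1:
  shows "infinite {s. tempered_xi s = 0 \<and> Re s \<noteq> 1 / 2}
    \<and> finite {s. tempered_xi s = 0 \<and> Re s = 1 / 2}
    \<and> simple_zero tempered_xi (1 / 2)"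
proof (intro conjI)
  show "infinite {s. tempered_xi s = 0 \<and> Re s \<noteq> 1 / 2}"
  proof
    assume "finite {s. tempered_xi s = 0 \<and> Re s \<noteq> 1 / 2}"
    from finite_UnI[OF this finite_critical_zeros] have "finite {s. tempered_xi s = 0}"
      by (rule rev_finite_subset) blast
    with infinite_zeros_tempered_xi show False by contradiction
  qed
  show "finite {s. tempered_xi s = 0 \<and> Re s = 1 / 2}"
    by (rule finite_critical_zeros)
  show "simple_zero tempered_xi (1 / 2)"
    by (rule simple_zero_tempered_xi)
qed

end
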